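(* Given a sequence $\{f_n\}_{n \geq 0} \subset \mathrm{Homeo}_0(\mathbb{R})$, there exists a set $S \subset \mathrm{Homeo}_0(\mathbb{R})$ with $|S| = 10$ such that every $f_n$ lies in the subgroup generated by $S$ and $\ell_S(f_n) \leq 14n+12$ holds for all $n$.
   Context: $\mathrm{Homeo}_0(\mathbb{R})$ is the group of orientation-preserving homeomorphisms of $\mathbb{R}$. For a subset $S$ of a group and $g$ in the subgroup generated by $S$, $\ell_S(g)$ denotes the word length of $g$ with respect to $S$, i.e. the minimal length of a word in elements of $S$ and their inverses representing $g$. *)

theory Defs
  imports "HOL-Analysis.Analysis" "HOL-Algebra.Generated_Groups"
begin

definition Homeo0 :: "(real \<Rightarrow> real) monoid" where
  "Homeo0 = \<lparr>carrier = {f. (\<exists>g. homeomorphism UNIV UNIV f g) \<and> strict_mono f},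
             mult = (\<lambda>f g. f \<circ> g), one = id\<rparr>"

definition represents_word :: "('a, 'b) monoid_scheme \<Rightarrow> 'a set \<Rightarrow> 'a list \<Rightarrow> 'a \<Rightarrow> bool" where
  "represents_word G S ws g \<longleftrightarrow>
     set ws \<subseteq> S \<union> m_inv G ` S \<and> foldr (mult G) ws (one G) = g"

(* Only meaningful for g in generate G S; for other g no word exists and the
   value of LEAST is unspecified. *)
definition word_length :: "('a, 'b) monoid_scheme \<Rightarrow> 'a set \<Rightarrow> 'a \<Rightarrow> nat" where
  "word_length G S g = (LEAST n. \<exists>ws. length ws = n \<and> represents_word G S ws g)"

lemma group_Homeo0: "group Homeo0"
proof (rule groupI)
  show "\<one>\<^bsub>Homeo0\<^esub> \<in> carrier Homeo0"
    by (auto simp: Homeo0_def strict_mono_def homeomorphism_def intro!: exI[of _ id])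
next
  fix x y assume x: "x \<in> carrier Homeo0" and y: "y \<in> carrier Homeo0"
  from x y obtain x' y' where "homeomorphism UNIV UNIV x x'" "homeomorphism UNIV UNIV y y'"
    by (auto simp: Homeo0_def)
  then have "homeomorphism UNIV UNIV (x \<circ> y) (y' \<circ> x')"
    using homeomorphism_compose by blast
  moreover have "strict_mono (x \<circ> y)"
    using x y by (auto simp: Homeo0_def strict_mono_def)
  ultimately show "x \<otimes>\<^bsub>Homeo0\<^esub> y \<in> carrier Homeo0"
    by (auto simp: Homeo0_def)
next
  fix x assume x: "x \<in> carrier Homeo0"
  then obtain x' where h: "homeomorphism UNIV UNIV x x'" by (auto simp: Homeo0_def)
  have m: "strict_mono x" using x by (auto simp: Homeo0_def)
  have "strict_mono x'"
  proof (rule strict_monoI)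
    fix a b :: real assume "a < b"
    then have "x (x' a) < x (x' b)" using h by (simp add: homeomorphism_def)
    then show "x' a < x' b" using m by (simp add: strict_mono_less)
  qed
  moreover have "homeomorphism UNIV UNIV x' x" using h by (rule homeomorphism_symD)
  moreover have "x' \<circ> x = id" using h by (auto simp: homeomorphism_def fun_eq_iff)
  ultimately show "\<exists>y\<in>carrier Homeo0. y \<otimes>\<^bsub>Homeo0\<^esub> x = \<one>\<^bsub>Homeo0\<^esub>"
    by (intro bexI[of _ x']) (auto simp: Homeo0_def)
qed (auto simp: Homeo0_def comp_assoc)

end

theory Submission
  imports Defs
begin

text \<open>After a conjugation by a coordinate change \<open>\<theta>\<close> that grows fast compared with the given
  sequence, \<open>f n\<close> moves points far from 0 (at distance of order \<open>n\<close>) only slightly, so conjugating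
  further by \<open>x \<mapsto> 2 ^ n * x\<close> makes it move every \<open>j + 1/4\<close> and \<open>j + 3/4\<close>, \<open>j\<close> an integer, only
  slightly. Such a homeomorphism is a product of two factors, one supported in the middle parts
  (cores) of the intervals \<open>[j, j + 1]\<close> and one supported in their translates by \<open>1/2\<close>.

  A sequence \<open>h n\<close> supported in the cores is written with three letters. Inside every interval
  \<open>[j, j + 1]\<close> the letter \<open>V\<close> moves a neighbourhood \<open>J\<close> of the core off itself to disjoint copies
  \<open>V ^ m J\<close>, the letter \<open>U\<close>, supported in \<open>J\<close>, moves the core \<open>I\<close> to disjoint copies \<open>U ^ k I\<close>, and
  \<open>A\<close> acts by a copy of \<open>h m\<close> on each \<open>V ^ m U ^ k I\<close> with \<open>m, k \<ge> 0\<close>. Then \<open>h n\<close> is the commutator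
  of \<open>V ^ (-n) A V ^ n\<close> and \<open>U\<close>, a word of length \<open>4 * n + 4\<close>.\<close>

section \<open>Homeomorphisms as increasing bijections of the line\<close>

definition aut :: "(real \<Rightarrow> real) \<Rightarrow> bool" where
  "aut f \<longleftrightarrow> strict_mono f \<and> surj f"

text \<open>The theories of HOL-Algebra use \<open>inv\<close> for the inverse in a group.\<close>

abbreviation fun_inv :: "(real \<Rightarrow> real) \<Rightarrow> real \<Rightarrow> real" where
  "fun_inv \<equiv> inv_into UNIV"

lemma strict_mono_inv:
  assumes "strict_mono f" "surj f"
  shows "strict_mono (fun_inv f)"
proof (rule strict_monoI)
  fix a b :: real assume "a < b"
  then have "f (fun_inv f a) < f (fun_inv f b)"
    using assms(2) by (simp add: surj_f_inv_f)
  then show "fun_inv f a < fun_inv f b"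
    using assms(1) by (simp add: strict_mono_less)
qed

text \<open>A strictly increasing surjection of the line has no jumps, so it is continuous, and its
  inverse is of the same kind.\<close>

lemma carrier_Homeo0: "carrier Homeo0 = Collect aut"
proof -
  have "\<exists>g. homeomorphism UNIV UNIV f g" if "aut f" for f
  proof -
    from that have m: "strict_mono f" and s: "surj f" by (auto simp: aut_def)
    have m': "strict_mono (fun_inv f)"
      using m s by (rule strict_mono_inv)
    have s': "surj (fun_inv f)"
      using m s by (simp add: inj_imp_surj_inv strict_mono_on_imp_inj_on)
    have "continuous_on UNIV f"
      using m s by (intro continuous_onI_mono) (auto simp: strict_mono_less_eq)
    moreover have "continuous_on UNIV (fun_inv f)"
      using m' s' by (intro continuous_onI_mono) (auto simp: strict_mono_less_eq)
    ultimately have "homeomorphism UNIV UNIV f (fun_inv f)"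
      using m s s' by (auto simp: homeomorphism_def strict_mono_on_imp_inj_on surj_f_inv_f)
    then show ?thesis by blast
  qed
  then show ?thesis
    by (auto simp: Homeo0_def aut_def homeomorphism_def)
qed

lemma mult_Homeo0: "f \<otimes>\<^bsub>Homeo0\<^esub> g = f \<circ> g"
  by (simp add: Homeo0_def)

lemma one_Homeo0: "\<one>\<^bsub>Homeo0\<^esub> = id"
  by (simp add: Homeo0_def)

lemma aut_id: "aut id"
  by (auto simp: aut_def strict_mono_def)

lemma aut_comp: "aut f \<Longrightarrow> aut g \<Longrightarrow> aut (f \<circ> g)"
  unfolding aut_def using comp_surj[of g f] by (simp add: strict_mono_def)

lemma aut_inj: "aut f \<Longrightarrow> inj f"
  by (simp add: aut_def strict_mono_on_imp_inj_on)

lemma aut_inv: "aut f \<Longrightarrow> aut (fun_inv f)"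
  unfolding aut_def
  by (simp add: strict_mono_inv inj_imp_surj_inv strict_mono_on_imp_inj_on)

lemma aut_inv_apply [simp]: "aut f \<Longrightarrow> fun_inv f (f x) = x" "aut f \<Longrightarrow> f (fun_inv f x) = x"
  by (auto simp: aut_inj surj_f_inv_f aut_def)

lemma aut_inv_comp [simp]: "aut f \<Longrightarrow> fun_inv f \<circ> f = id" "aut f \<Longrightarrow> f \<circ> fun_inv f = id"
  by (auto simp: fun_eq_iff)

lemma aut_le_iff: "aut f \<Longrightarrow> f x \<le> f y \<longleftrightarrow> x \<le> y"
  by (simp add: aut_def strict_mono_less_eq)

lemma aut_inv_le_iff: "aut f \<Longrightarrow> fun_inv f x \<le> y \<longleftrightarrow> x \<le> f y"
  using aut_le_iff[of f "fun_inv f x" y] by simp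

lemma aut_le_inv_iff: "aut f \<Longrightarrow> x \<le> fun_inv f y \<longleftrightarrow> f x \<le> y"
  using aut_le_iff[of f x "fun_inv f y"] by simp

lemma aut_less_iff: "aut f \<Longrightarrow> f x < f y \<longleftrightarrow> x < y"
  by (simp add: aut_def strict_mono_less)

lemma autI:
  assumes "strict_mono f" "\<And>y. \<exists>x. f x = y"
  shows "aut f"
  using assms by (metis aut_def surjI)

lemma aut_max:
  assumes "aut f" "aut g"
  shows "aut (\<lambda>x. max (f x) (g x))"
proof (rule autI)
  show "strict_mono (\<lambda>x. max (f x) (g x))"
  proof (rule strict_monoI)
    fix x y :: real assume "x < y"
    with assms have "f x < f y" "g x < g y" by (simp_all add: aut_less_iff)
    then show "max (f x) (g x) < max (f y) (g y)" by linarith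
  qed
  fix y
  show "\<exists>x. max (f x) (g x) = y"
  proof (intro exI)
    \<comment> \<open>The smaller of the two preimages of \<open>y\<close> works: there one map
      takes the value \<open>y\<close> and the other a value at most \<open>y\<close>.\<close>
    show "max (f (min (fun_inv f y) (fun_inv g y))) (g (min (fun_inv f y) (fun_inv g y))) = y"
      using assms by (smt (verit) aut_inv_apply(2) aut_le_iff)
  qed
qed

lemma aut_min:
  assumes "aut f" "aut g"
  shows "aut (\<lambda>x. min (f x) (g x))"
proof (rule autI)
  show "strict_mono (\<lambda>x. min (f x) (g x))"
  proof (rule strict_monoI)
    fix x y :: real assume "x < y"
    with assms have "f x < f y" "g x < g y" by (simp_all add: aut_less_iff)
    then show "min (f x) (g x) < min (f y) (g y)" by linarith
  qed
  fix y
  show "\<exists>x. min (f x) (g x) = y"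
  proof (intro exI)
    show "min (f (max (fun_inv f y) (fun_inv g y))) (g (max (fun_inv f y) (fun_inv g y))) = y"
      using assms by (smt (verit) aut_inv_apply(2) aut_le_iff)
  qed
qed

lemma aut_translation: "aut (\<lambda>x. x + r)"
  by (rule autI) (auto simp: strict_mono_def intro: exI[of _ "_ - r"])

lemma aut_scale: "c > 0 \<Longrightarrow> aut (\<lambda>x. c * x)"
  by (rule autI) (auto simp: strict_mono_def intro: exI[of _ "_ / c"])

lemma inv_Homeo0: "aut f \<Longrightarrow> inv\<^bsub>Homeo0\<^esub> f = fun_inv f"
  by (rule group.inv_equality[OF group_Homeo0])
     (auto simp: carrier_Homeo0 aut_inv mult_Homeo0, simp add: Homeo0_def)

lemma infinite_Homeo0: "infinite (carrier Homeo0)"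
proof -
  have "inj (\<lambda>r x::real. x + r)"
    by (auto simp: inj_on_def fun_eq_iff)
  then have "infinite (range (\<lambda>r x::real. x + r))"
    using finite_imageD infinite_UNIV_char_0 by blast
  moreover have "range (\<lambda>r x::real. x + r) \<subseteq> carrier Homeo0"
    by (auto simp: carrier_Homeo0 aut_translation)
  ultimately show ?thesis
    using finite_subset by blast
qed


section \<open>Words of bounded length\<close>

text \<open>An upper bound in place of the minimal length: it adds up under products and survives
  enlarging the set. The minimum enters only through \<open>word_length_le\<close>.\<close>

definition short_word :: "('a, 'b) monoid_scheme \<Rightarrow> 'a set \<Rightarrow> nat \<Rightarrow> 'a \<Rightarrow> bool" where
  "short_word G S k g \<longleftrightarrow> (\<exists>ws. length ws \<le> k \<and> represents_word G S ws g)"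

lemma short_word_mono:
  "short_word G S k g \<Longrightarrow> S \<subseteq> S' \<Longrightarrow> k \<le> k' \<Longrightarrow> short_word G S' k' g"
  unfolding short_word_def represents_word_def
  by (elim exE conjE, rename_tac ws, rule_tac x = ws in exI) auto

lemma (in group) letters_closed: "S \<subseteq> carrier G \<Longrightarrow> S \<union> m_inv G ` S \<subseteq> carrier G"
  by auto

lemma (in group) foldr_mult_closed: "set ws \<subseteq> carrier G \<Longrightarrow> foldr (\<otimes>) ws \<one> \<in> carrier G"
  by (induction ws) auto

lemma (in group) foldr_mult_append:
  "set ws \<subseteq> carrier G \<Longrightarrow> set vs \<subseteq> carrier G \<Longrightarrow>
    foldr (\<otimes>) (ws @ vs) \<one> = foldr (\<otimes>) ws \<one> \<otimes> foldr (\<otimes>) vs \<one>"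
proof (induction ws)
  case Nil
  then show ?case by (simp add: foldr_mult_closed del: foldr_append)
next
  case (Cons a ws)
  then show ?case by (simp add: foldr_mult_closed m_assoc del: foldr_append)
qed

lemma (in group) short_word_mult:
  assumes "S \<subseteq> carrier G" "short_word G S k g" "short_word G S l h"
  shows "short_word G S (k + l) (g \<otimes> h)"
proof -
  from assms(2,3) obtain ws vs where
    "length ws \<le> k" "set ws \<subseteq> S \<union> m_inv G ` S" "foldr (\<otimes>) ws \<one> = g"
    "length vs \<le> l" "set vs \<subseteq> S \<union> m_inv G ` S" "foldr (\<otimes>) vs \<one> = h"
    by (auto simp: short_word_def represents_word_def)
  with foldr_mult_append[of ws vs] letters_closed[OF assms(1)] show ?thesis
    unfolding short_word_def represents_word_def by (intro exI[of _ "ws @ vs"]) auto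
qed

lemma (in group) short_word_one: "short_word G S 0 \<one>"
  by (auto simp: short_word_def represents_word_def)

lemma (in group) short_word_letter:
  "S \<subseteq> carrier G \<Longrightarrow> g \<in> S \<union> m_inv G ` S \<Longrightarrow> short_word G S 1 g"
  using letters_closed[of S]
  by (auto simp: short_word_def represents_word_def intro!: exI[of _ "[g]"])

lemma (in group) inv_conjugate:
  "x \<in> carrier G \<Longrightarrow> s \<in> carrier G \<Longrightarrow> inv (x \<otimes> s \<otimes> inv x) = x \<otimes> inv s \<otimes> inv x"
  by (simp add: inv_mult_group m_assoc)

lemma (in group) inv_cancel:
  "x \<in> carrier G \<Longrightarrow> y \<in> carrier G \<Longrightarrow> inv x \<otimes> (x \<otimes> y) = y"
  by (simp add: m_assoc[symmetric])

text \<open>Conjugate letter by letter; the adjacent factors \<open>inv x\<close> and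
  \<open>x\<close> cancel. A change of coordinates thus costs no length if the generators are
  conjugated too.\<close>

lemma (in group) short_word_conjugate:
  assumes S: "S \<subseteq> carrier G" and x: "x \<in> carrier G" and g: "short_word G S k g"
  shows "short_word G ((\<lambda>s. x \<otimes> s \<otimes> inv x) ` S) k (x \<otimes> g \<otimes> inv x)"
proof -
  let ?c = "\<lambda>s. x \<otimes> s \<otimes> inv x"
  from g obtain ws where ws: "length ws \<le> k" "set ws \<subseteq> S \<union> m_inv G ` S" "foldr (\<otimes>) ws \<one> = g"
    by (auto simp: short_word_def represents_word_def)
  have "foldr (\<otimes>) (map ?c ws) \<one> = ?c (foldr (\<otimes>) ws \<one>)" if "set ws \<subseteq> carrier G" for ws
    using that x
  proof (induction ws)
    case (Cons a ws)
    then have "foldr (\<otimes>) ws \<one> \<in> carrier G" by (simp add: foldr_mult_closed)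
    with Cons show ?case by (simp add: m_assoc inv_cancel)
  qed simp
  moreover have "?c ` (S \<union> m_inv G ` S) \<subseteq> ?c ` S \<union> m_inv G ` ?c ` S"
    using S x inv_conjugate by (force simp: image_iff)
  moreover have "set ws \<subseteq> carrier G"
    using ws(2) letters_closed[OF S] by (rule order_trans)
  moreover have "?c ` set ws \<subseteq> ?c ` (S \<union> m_inv G ` S)"
    using ws(2) by (rule image_mono)
  ultimately have "set (map ?c ws) \<subseteq> ?c ` S \<union> m_inv G ` ?c ` S"
    "foldr (\<otimes>) (map ?c ws) \<one> = ?c g"
    using ws(3) by (simp_all only: set_map)
  with ws(1) show ?thesis
    unfolding short_word_def represents_word_def by (intro exI[of _ "map ?c ws"]) simp
qed

lemma (in group) short_word_generate:
  assumes "S \<subseteq> carrier G" "short_word G S k g"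
  shows "g \<in> generate G S"
proof -
  have "foldr (\<otimes>) ws \<one> \<in> generate G S" if "set ws \<subseteq> S \<union> m_inv G ` S" for ws
    using that by (induction ws) (auto intro: generate.intros)
  with assms(2) show ?thesis by (auto simp: short_word_def represents_word_def)
qed

lemma word_length_le:
  assumes "short_word G S k g"
  shows "word_length G S g \<le> k"
proof -
  from assms obtain ws where ws: "length ws \<le> k" "represents_word G S ws g"
    by (auto simp: short_word_def)
  then have "word_length G S g \<le> length ws"
    unfolding word_length_def by (intro Least_le) auto
  with ws(1) show ?thesis by simp
qed

lemma short_word_funpow:
  assumes "S \<subseteq> carrier Homeo0" "s \<in> S \<union> m_inv Homeo0 ` S"
  shows "short_word Homeo0 S n (s ^^ n)"
proof (induction n)
  case 0
  then show ?case
    using group.short_word_one[OF group_Homeo0, of S] by (simp add: one_Homeo0 id_def)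
next
  case (Suc n)
  from group.short_word_mult[OF group_Homeo0 assms(1)
      group.short_word_letter[OF group_Homeo0 assms] Suc]
  show ?case by (simp only: mult_Homeo0 funpow.simps plus_1_eq_Suc)
qed


section \<open>Acting independently on the cells between consecutive integers\<close>

text \<open>The factors 14 and 7 make \<open>squeeze\<close> so steep that \<open>squeeze (squeeze 0) < 1/4\<close> and
  \<open>squeeze (squeeze 1) > 3/4\<close>.\<close>

definition squeeze :: "real \<Rightarrow> real" where
  "squeeze x = (1 + (14 * x - 7) / (1 + \<bar>14 * x - 7\<bar>)) / 2"

definition unsqueeze :: "real \<Rightarrow> real" where
  "unsqueeze u = ((2 * u - 1) / (1 - \<bar>2 * u - 1\<bar>) + 7) / 14"

lemma squeeze_bounds: "0 < squeeze x" "squeeze x < 1"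
  by (auto simp: squeeze_def field_simps abs_if)

lemma unsqueeze_squeeze [simp]: "unsqueeze (squeeze x) = x"
proof -
  define z where "z = 14 * x - 7"
  have "2 * ((1 + q) / 2) - 1 = q" for q :: real by (simp add: field_simps)
  then have "2 * squeeze x - 1 = z / (1 + \<bar>z\<bar>)"
    unfolding squeeze_def z_def .
  moreover have "1 - \<bar>z / (1 + \<bar>z\<bar>)\<bar> = 1 / (1 + \<bar>z\<bar>)"
  proof -
    have "1 - a / (1 + a) = 1 / (1 + a)" if "0 \<le> a" for a :: real
      using that by (simp add: field_simps)
    from this[of "\<bar>z\<bar>"] show ?thesis by (simp add: abs_divide)
  qed
  ultimately have "unsqueeze (squeeze x) = (z + 7) / 14"
    by (simp add: unsqueeze_def)
  then show ?thesis by (simp add: z_def)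
qed

lemma squeeze_unsqueeze:
  assumes "0 < u" "u < 1"
  shows "squeeze (unsqueeze u) = u"
proof -
  define v where "v = 2 * u - 1"
  have v: "\<bar>v\<bar> < 1" using assms by (auto simp: v_def)
  have "14 * ((q + 7) / 14) - 7 = q" for q :: real by (simp add: field_simps)
  then have "14 * unsqueeze u - 7 = v / (1 - \<bar>v\<bar>)"
    unfolding unsqueeze_def v_def .
  moreover have "1 + \<bar>v / (1 - \<bar>v\<bar>)\<bar> = 1 / (1 - \<bar>v\<bar>)"
    using v by (simp add: abs_divide field_simps)
  ultimately have "squeeze (unsqueeze u) = (1 + v) / 2"
    using v by (simp add: squeeze_def)
  then show ?thesis by (simp add: v_def)
qed

lemma squeeze_less_iff [simp]: "squeeze x < squeeze y \<longleftrightarrow> x < y"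
proof -
  have *: "squeeze x < squeeze y" if "x < y" for x y
  proof -
    have "a / (1 + \<bar>a\<bar>) < b / (1 + \<bar>b\<bar>)" if "a < b" for a b :: real
    proof -
      \<comment> \<open>For equal signs \<open>a * \<bar>b\<bar> = b * \<bar>a\<bar>\<close>, which
        leaves \<open>a < b\<close>; otherwise \<open>a \<le> 0 \<le> b\<close> and the signs
        decide.\<close>
      have "a * (1 + \<bar>b\<bar>) < b * (1 + \<bar>a\<bar>)"
        using that by (smt (verit) mult_less_0_iff mult.commute distrib_left mult_minus_right mult_cancel_left1 mult_nonneg_nonneg)
      moreover have "0 < 1 + \<bar>a\<bar>" "0 < 1 + \<bar>b\<bar>" by auto
      ultimately show ?thesis by (simp only: frac_less_eq pos_divide_less_eq pos_less_divide_eq times_divide_eq_left)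
    qed
    from this[of "14 * x - 7" "14 * y - 7"] that show ?thesis
      unfolding squeeze_def by (intro divide_strict_right_mono add_strict_left_mono) auto
  qed
  show ?thesis using *[of x y] *[of y x] by (cases x y rule: linorder_cases) auto
qed

lemma squeeze_le_iff [simp]: "squeeze x \<le> squeeze y \<longleftrightarrow> x \<le> y"
  by (simp add: linorder_not_less[symmetric])

lemma squeeze_squeeze_0: "squeeze (squeeze 0) < 1/4"
  by (simp add: squeeze_def)

lemma squeeze_squeeze_1: "squeeze (squeeze 1) > 3/4"
  by (simp add: squeeze_def)

text \<open>Identifies each open interval \<open>(j, j + 1)\<close> with the line through \<open>y \<mapsto> j + squeeze y\<close> and lets
  \<open>g j\<close> act there.\<close>

definition on_cells :: "(int \<Rightarrow> real \<Rightarrow> real) \<Rightarrow> real \<Rightarrow> real" where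
  "on_cells g x = (if x = of_int \<lfloor>x\<rfloor> then x
     else of_int \<lfloor>x\<rfloor> + squeeze (g \<lfloor>x\<rfloor> (unsqueeze (x - of_int \<lfloor>x\<rfloor>))))"

lemma floor_cell [simp]: "\<lfloor>of_int j + squeeze y\<rfloor> = j"
  using squeeze_bounds[of y] by (simp add: floor_eq_iff)

text \<open>Gives every non-integer a coordinate \<open>y\<close> in its cell, so that identities
  between \<open>on_cells\<close> maps reduce to two rewrite rules.\<close>

lemma cell_cases:
  obtains (int) j where "x = of_int j" | (cell) j y where "x = of_int j + squeeze y"
proof (cases "x = of_int \<lfloor>x\<rfloor>")
  case True
  then show ?thesis using int by blast
next
  case False
  then have "0 < x - of_int \<lfloor>x\<rfloor>" "x - of_int \<lfloor>x\<rfloor> < 1"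
    by linarith+
  then have "x = of_int \<lfloor>x\<rfloor> + squeeze (unsqueeze (x - of_int \<lfloor>x\<rfloor>))"
    by (simp add: squeeze_unsqueeze)
  then show ?thesis using cell by blast
qed

lemma on_cells_int [simp]: "on_cells g (of_int j) = of_int j"
  by (simp add: on_cells_def)

lemma on_cells_cell [simp]: "on_cells g (of_int j + squeeze y) = of_int j + squeeze (g j y)"
  using squeeze_bounds[of y] by (simp add: on_cells_def)

lemma on_cells_comp: "on_cells g \<circ> on_cells h = on_cells (\<lambda>j. g j \<circ> h j)"
proof
  fix x show "(on_cells g \<circ> on_cells h) x = on_cells (\<lambda>j. g j \<circ> h j) x"
    by (cases x rule: cell_cases) auto
qed

lemma on_cells_id [simp]: "on_cells (\<lambda>j. id) = id"
proof
  fix x show "on_cells (\<lambda>j. id) x = id x"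
    by (cases x rule: cell_cases) auto
qed

lemma floor_on_cells: "\<lfloor>on_cells g x\<rfloor> = \<lfloor>x\<rfloor>"
  by (cases x rule: cell_cases) auto

lemma aut_on_cells:
  assumes "\<And>j. aut (g j)"
  shows "aut (on_cells g)"
proof (rule autI)
  show "strict_mono (on_cells g)"
  proof (rule strict_monoI)
    fix x y :: real assume "x < y"
    show "on_cells g x < on_cells g y"
    proof (cases "\<lfloor>x\<rfloor> = \<lfloor>y\<rfloor>")
      case False
      with \<open>x < y\<close> have "\<lfloor>on_cells g x\<rfloor> < \<lfloor>on_cells g y\<rfloor>"
        by (simp add: floor_on_cells floor_mono order_less_le)
      then show ?thesis by (meson floor_less_cancel)
    next
      case True
      with \<open>x < y\<close> show ?thesis
        using squeeze_bounds
        by (cases x rule: cell_cases; cases y rule: cell_cases) (auto simp: assms aut_less_iff dest: less_trans)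
    qed
  qed
  fix y
  have "on_cells g \<circ> on_cells (\<lambda>j. fun_inv (g j)) = id"
    by (simp add: on_cells_comp assms)
  then show "\<exists>x. on_cells g x = y"
    by (metis comp_apply id_apply)
qed

definition shift :: "int \<Rightarrow> real \<Rightarrow> real" where
  "shift n x = x + of_int n"

lemma aut_shift: "aut (shift n)"
  using aut_translation[of "of_int n"] by (simp add: shift_def[abs_def])

lemma shift_0: "shift 0 = id"
  by (simp add: shift_def fun_eq_iff)

lemma shift_comp: "shift m \<circ> shift n = shift (m + n)"
  by (simp add: shift_def fun_eq_iff)

text \<open>An integer translation carries cells to cells and keeps the coordinate \<open>y\<close>,
  so conjugation by it only renumbers the maps.\<close>

lemma shift_on_cells: "shift (- n) \<circ> on_cells g \<circ> shift n = on_cells (\<lambda>j. g (j + n))"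
proof
  fix x
  have "on_cells g (of_int (j + n) + squeeze y) = of_int (j + n) + squeeze (g (j + n) y)" for j y
    by (rule on_cells_cell)
  moreover have "on_cells g (of_int (j + n)) = of_int (j + n)" for j
    by (rule on_cells_int)
  ultimately show "(shift (- n) \<circ> on_cells g \<circ> shift n) x = on_cells (\<lambda>j. g (j + n)) x"
    by (cases x rule: cell_cases) (auto simp: shift_def algebra_simps)
qed

text \<open>An increasing map that fixes the integers preserves every open cell, so it can be read
  in the coordinate of each cell separately.\<close>

lemma on_cells_surj:
  assumes h: "aut h" and fixed: "\<And>j. h (of_int j) = of_int j"
  obtains g where "\<And>j. aut (g j)" "h = on_cells g"
proof
  define g where "g j y = unsqueeze (h (of_int j + squeeze y) - of_int j)" for j :: int and y
  have sq: "squeeze (g j y) = h (of_int j + squeeze y) - of_int j" for j y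
  proof -
    have "h (of_int j) < h (of_int j + squeeze y)" "h (of_int j + squeeze y) < h (of_int (j + 1))"
      using h squeeze_bounds[of y] by (simp_all add: aut_less_iff)
    then show ?thesis
      unfolding g_def using fixed[of j] fixed[of "j + 1"] by (intro squeeze_unsqueeze) auto
  qed
  show "h = on_cells g"
  proof
    fix x show "h x = on_cells g x"
      by (cases x rule: cell_cases) (auto simp: fixed sq)
  qed
  show "aut (g j)" for j
  proof (rule autI)
    show "strict_mono (g j)"
    proof (rule strict_monoI)
      fix x y :: real assume "x < y"
      then have "squeeze (g j x) < squeeze (g j y)"
        using h by (simp add: sq aut_less_iff)
      then show "g j x < g j y" by simp
    qed
    fix y
    obtain x where x: "h x = of_int j + squeeze y"
      using h by (metis aut_inv_apply(2))
    then have "h (of_int j) < h x" "h x < h (of_int (j + 1))"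
      using squeeze_bounds[of y] fixed[of j] fixed[of "j + 1"] by auto
    then have "0 < x - of_int j" "x - of_int j < 1"
      using h by (simp_all add: aut_less_iff)
    then have "squeeze (unsqueeze (x - of_int j)) = x - of_int j"
      by (rule squeeze_unsqueeze)
    then have "g j (unsqueeze (x - of_int j)) = y"
      by (simp add: g_def x)
    then show "\<exists>x. g j x = y" ..
  qed
qed

definition on_unit_cell :: "(real \<Rightarrow> real) \<Rightarrow> real \<Rightarrow> real" where
  "on_unit_cell g = on_cells (\<lambda>j. if j = 0 then g else id)"

lemma aut_on_unit_cell: "aut g \<Longrightarrow> aut (on_unit_cell g)"
  unfolding on_unit_cell_def by (rule aut_on_cells) (simp add: aut_id)

lemma on_unit_cell_squeeze [simp]: "on_unit_cell g (squeeze y) = squeeze (g y)"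
  using on_cells_cell[of _ 0 y] by (simp add: on_unit_cell_def)

lemma on_unit_cell_outside:
  assumes "x \<le> 0 \<or> 1 \<le> x"
  shows "on_unit_cell g x = x"
proof (cases x rule: cell_cases)
  case (int j)
  then show ?thesis by (simp add: on_unit_cell_def)
next
  case (cell j y)
  with assms squeeze_bounds[of y] have "j \<noteq> 0" by auto
  with cell show ?thesis by (simp add: on_unit_cell_def)
qed

lemma on_unit_cell_surj:
  assumes h: "aut h" and fixed: "\<And>x. x \<le> 0 \<or> 1 \<le> x \<Longrightarrow> h x = x"
  obtains g where "aut g" "h = on_unit_cell g"
proof -
  have "h (of_int j) = of_int j" for j :: int
    using fixed by (cases "j \<le> 0") auto
  with h obtain g where g: "\<And>j. aut (g j)" "h = on_cells g"
    using on_cells_surj by blast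
  have "g j = id" if "j \<noteq> 0" for j
  proof
    fix y
    have "of_int j + squeeze y \<le> 0 \<or> 1 \<le> of_int j + squeeze y"
      using that squeeze_bounds[of y] by (cases "j < 0") linarith+
    then have "of_int j + squeeze (g j y) = of_int j + squeeze y"
      using fixed[of "of_int j + squeeze y"] g(2) by simp
    then show "g j y = id y"
      by (metis add_left_cancel id_apply unsqueeze_squeeze)
  qed
  then have "h = on_unit_cell (g 0)"
    unfolding g(2) on_unit_cell_def by (intro arg_cong[of _ _ on_cells]) auto
  with g(1) that show ?thesis by blast
qed


section \<open>The swindle\<close>

text \<open>The bounds are the ends of the unit cell of the unit cell, seen inside
  \<open>[j, j + 1]\<close>; this is the level at which two nested \<open>on_unit_cell\<close> act.
  The closed interval \<open>{0..1}\<close> makes the integers fixed as well.\<close>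

definition core_supported :: "(real \<Rightarrow> real) \<Rightarrow> bool" where
  "core_supported h \<longleftrightarrow> (\<forall>j x. x \<in> {0..1} - {squeeze (squeeze 0)<..<squeeze (squeeze 1)} \<longrightarrow>
     h (of_int j + x) = of_int j + x)"

lemma core_supported_on_cells: "core_supported (on_cells (\<lambda>j. on_unit_cell (on_unit_cell (g j))))"
  unfolding core_supported_def
proof (intro allI impI)
  fix j :: int and x :: real
  let ?h = "on_cells (\<lambda>j. on_unit_cell (on_unit_cell (g j)))"
  assume x: "x \<in> {0..1} - {squeeze (squeeze 0)<..<squeeze (squeeze 1)}"
  show "?h (of_int j + x) = of_int j + x"
  proof (cases "x = 0 \<or> x = 1")
    case True
    then show ?thesis
      using on_cells_int[of _ j] on_cells_int[of _ "j + 1"] by auto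
  next
    case False
    with x have "squeeze (unsqueeze x) = x" by (intro squeeze_unsqueeze) auto
    then obtain y where y: "x = squeeze y" by metis
    with x have y': "y \<le> squeeze 0 \<or> squeeze 1 \<le> y" by auto
    have "on_unit_cell (on_unit_cell (g j)) y = y"
    proof (cases "y \<le> 0 \<or> 1 \<le> y")
      case True
      then show ?thesis by (rule on_unit_cell_outside)
    next
      case False
      then have "squeeze (unsqueeze y) = y" by (intro squeeze_unsqueeze) auto
      then obtain z where z: "y = squeeze z" by metis
      with y' have "z \<le> 0 \<or> 1 \<le> z" by simp
      with z show ?thesis by (simp add: on_unit_cell_outside)
    qed
    with y show ?thesis by simp
  qed
qed

lemma core_supportedE:
  assumes "aut h" "core_supported h"
  obtains g where "\<And>j. aut (g j)" "h = on_cells (\<lambda>j. on_unit_cell (on_unit_cell (g j)))"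
proof -
  have c: "h (of_int j + x) = of_int j + x"
    if "0 \<le> x" "x \<le> 1" "x \<le> squeeze (squeeze 0) \<or> squeeze (squeeze 1) \<le> x" for j x
    using assms(2) that by (auto simp: core_supported_def)
  have "h (of_int j) = of_int j" for j
    using c[of 0 j] squeeze_bounds[of "squeeze 0"] by simp
  with assms(1) obtain g where g: "\<And>j. aut (g j)" "h = on_cells g"
    using on_cells_surj by blast
  have fixed: "g j y = y" if "y \<le> squeeze 0 \<or> squeeze 1 \<le> y" for j y
  proof -
    have "h (of_int j + squeeze y) = of_int j + squeeze y"
      using that squeeze_bounds[of y] by (intro c) auto
    then show ?thesis
      unfolding g(2) by (metis add_left_cancel on_cells_cell unsqueeze_squeeze)
  qed
  have "\<exists>k. aut k \<and> g j = on_unit_cell (on_unit_cell k)" for j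
  proof -
    have "g j y = y" if "y \<le> 0 \<or> 1 \<le> y" for y
      using that squeeze_bounds[of 0] squeeze_bounds[of 1] by (intro fixed) linarith
    then obtain k where k: "aut k" "g j = on_unit_cell k"
      using on_unit_cell_surj g(1) by blast
    have "k y = y" if "y \<le> 0 \<or> 1 \<le> y" for y
      using fixed[of "squeeze y" j] that by (metis k(2) on_unit_cell_squeeze squeeze_le_iff unsqueeze_squeeze)
    then show ?thesis
      using on_unit_cell_surj k by metis
  qed
  then obtain k where "\<And>j. aut (k j) \<and> g j = on_unit_cell (on_unit_cell (k j))"
    by metis
  with that[of k] g(2) show ?thesis by (metis (no_types, lifting) ext)
qed

definition on_half_line :: "(real \<Rightarrow> real) \<Rightarrow> real \<Rightarrow> real" where
  "on_half_line g = on_cells (\<lambda>k. if k \<ge> 0 then g else id)"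

lemma aut_on_half_line: "aut g \<Longrightarrow> aut (on_half_line g)"
  unfolding on_half_line_def by (rule aut_on_cells) (simp add: aut_id)

lemma on_half_line_inv: "aut g \<Longrightarrow> on_half_line g \<circ> on_half_line (fun_inv g) = id"
proof -
  assume "aut g"
  then have "(\<lambda>k::int. (if k \<ge> 0 then g else id) \<circ> (if k \<ge> 0 then fun_inv g else id)) = (\<lambda>k. id)"
    by auto
  then show ?thesis
    by (simp add: on_half_line_def on_cells_comp)
qed

text \<open>The conjugate by \<open>shift 1\<close> acts by \<open>fun_inv g\<close> on the cells
  from 1 on and cancels the copies of \<open>g\<close> there; only the copy in cell 0
  survives.\<close>

lemma on_half_line_commutator:
  assumes "aut g"
  shows "on_half_line g \<circ> shift 1 \<circ> on_half_line (fun_inv g) \<circ> shift (- 1) = on_unit_cell g"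
proof -
  have "on_half_line g \<circ> (shift (- (- 1)) \<circ> on_half_line (fun_inv g) \<circ> shift (- 1)) =
    on_cells (\<lambda>k. (if k \<ge> 0 then g else id) \<circ> (if k + - 1 \<ge> 0 then fun_inv g else id))"
    unfolding on_half_line_def shift_on_cells on_cells_comp ..
  also have "\<dots> = on_unit_cell g"
    unfolding on_unit_cell_def using assms by (intro arg_cong[of _ _ on_cells]) auto
  finally show ?thesis by (simp add: comp_assoc)
qed

text \<open>In the coordinates of one interval \<open>[j, j + 1]\<close>: \<open>stack\<close> is \<open>A\<close>, \<open>shift 1\<close> is \<open>V\<close> and
  \<open>on_unit_cell (shift 1)\<close> is \<open>U\<close>.\<close>

definition stack :: "(nat \<Rightarrow> real \<Rightarrow> real) \<Rightarrow> real \<Rightarrow> real" where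
  "stack g = on_cells (\<lambda>m. if m \<ge> 0 then on_half_line (g (nat m)) else id)"

lemma aut_stack: "(\<And>n. aut (g n)) \<Longrightarrow> aut (stack g)"
  unfolding stack_def by (rule aut_on_cells) (simp add: aut_id aut_on_half_line)

lemma stack_inv: "(\<And>n. aut (g n)) \<Longrightarrow> stack g \<circ> stack (\<lambda>n. fun_inv (g n)) = id"
proof -
  assume "\<And>n. aut (g n)"
  then have "(\<lambda>m. (if m \<ge> 0 then on_half_line (g (nat m)) else id) \<circ>
      (if m \<ge> 0 then on_half_line (fun_inv (g (nat m))) else id)) = (\<lambda>m. id)"
    by (auto simp: on_half_line_inv)
  then show ?thesis
    by (simp add: stack_def on_cells_comp)
qed

text \<open>The translation brings layer \<open>n\<close> of \<open>stack g\<close> into cell 0. In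
  every other cell \<open>on_unit_cell (shift 1)\<close> is the identity and the two stacks cancel;
  in cell 0 \<open>on_half_line_commutator\<close> applies.\<close>

lemma stack_commutator:
  assumes "\<And>n. aut (g n)"
  shows "(shift (- int n) \<circ> stack g \<circ> shift (int n)) \<circ> on_unit_cell (shift 1) \<circ>
    (shift (- int n) \<circ> stack (\<lambda>n. fun_inv (g n)) \<circ> shift (int n)) \<circ> on_unit_cell (shift (- 1)) =
    on_unit_cell (on_unit_cell (g n))"
proof -
  let ?b = "\<lambda>g m. if m + int n \<ge> 0 then on_half_line (g (nat (m + int n))) else id"
  let ?s = "\<lambda>k m. if m = (0::int) then shift k else id"
  have "?b g m \<circ> ?s 1 m \<circ> ?b (\<lambda>n. fun_inv (g n)) m \<circ> ?s (- 1) m =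
      (if m = 0 then on_unit_cell (g n) else id)" for m
    using on_half_line_commutator[of "g n"] on_half_line_inv[OF assms] assms by auto
  then show ?thesis
    unfolding stack_def shift_on_cells
    unfolding on_unit_cell_def[of "shift _"] on_unit_cell_def[of "on_unit_cell _"] on_cells_comp
    by presburger
qed

lemma fun_inv_unique: "aut f \<Longrightarrow> f \<circ> g = id \<Longrightarrow> fun_inv f = g"
  by (metis aut_inv_comp(1) comp_assoc comp_id id_comp)

lemma short_word_inv_letter:
  assumes "S \<subseteq> carrier Homeo0" "f \<in> S" "f \<circ> g = id"
  shows "g \<in> S \<union> m_inv Homeo0 ` S"
proof -
  have "aut f" using assms(1,2) by (auto simp: carrier_Homeo0)
  with assms(3) have "inv\<^bsub>Homeo0\<^esub> f = g"
    by (simp add: inv_Homeo0 fun_inv_unique)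
  with assms(2) show ?thesis by auto
qed

text \<open>The maps \<open>g n j\<close> vary with the interval \<open>j\<close>, yet three letters
  suffice, since each letter acts in all intervals at once.\<close>

lemma swindle:
  assumes "\<And>n. aut (h n)" "\<And>n. core_supported (h n)"
  obtains S where "S \<subseteq> carrier Homeo0" "finite S" "card S \<le> 3"
    "\<And>n. short_word Homeo0 S (4 * n + 4) (h n)"
proof -
  have "\<exists>g. \<forall>j. aut (g j) \<and> h n = on_cells (\<lambda>j. on_unit_cell (on_unit_cell (g j)))" for n
    using core_supportedE[OF assms] by metis
  then obtain g where g: "\<And>n j. aut (g n j)"
      "\<And>n. h n = on_cells (\<lambda>j. on_unit_cell (on_unit_cell (g n j)))"
    by metis
  define V where "V k = on_cells (\<lambda>j. shift k)" for k
  define U where "U k = on_cells (\<lambda>j. on_unit_cell (shift k))" for k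
  define A where "A = on_cells (\<lambda>j. stack (\<lambda>n. g n j))"
  define A' where "A' = on_cells (\<lambda>j. stack (\<lambda>n. fun_inv (g n j)))"
  define S where "S = {V 1, U 1, A}"
  have S: "S \<subseteq> carrier Homeo0"
    using g(1) by (auto simp: S_def V_def U_def A_def carrier_Homeo0
        intro!: aut_on_cells aut_shift aut_on_unit_cell aut_stack)
  have V_add: "V a \<circ> V b = V (a + b)" for a b
    by (simp add: V_def on_cells_comp shift_comp)
  have V_0: "V 0 = id"
    by (simp add: V_def shift_0)
  have "(\<lambda>j. (if j = (0::int) then shift 1 else id) \<circ> (if j = 0 then shift (- 1) else id)) = (\<lambda>j. id)"
    by (auto simp: shift_comp shift_0)
  then have U_inv: "U 1 \<circ> U (- 1) = id"
    by (simp add: U_def on_unit_cell_def on_cells_comp)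
  have A_inv: "A \<circ> A' = id"
    using g(1) by (simp add: A_def A'_def on_cells_comp stack_inv)
  have V_mult: "V (k * int n) = V k ^^ n" for k n
  proof (induction n)
    case (Suc n)
    have "V (k * int (Suc n)) = V k \<circ> V (k * int n)"
      by (simp add: V_add algebra_simps)
    with Suc show ?case by simp
  qed (simp add: V_0 id_def)
  have V_pow: "V (int n) = V 1 ^^ n" "V (- int n) = V (- 1) ^^ n" for n
    using V_mult[of 1 n] V_mult[of "- 1" n] by simp_all
  have letters: "V 1 \<in> S \<union> m_inv Homeo0 ` S" "V (- 1) \<in> S \<union> m_inv Homeo0 ` S"
    "U 1 \<in> S \<union> m_inv Homeo0 ` S" "U (- 1) \<in> S \<union> m_inv Homeo0 ` S"
    "A \<in> S \<union> m_inv Homeo0 ` S" "A' \<in> S \<union> m_inv Homeo0 ` S"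
    using short_word_inv_letter[OF S, of "V 1" "V (- 1)"] short_word_inv_letter[OF S, of "U 1" "U (- 1)"]
      short_word_inv_letter[OF S, of A A'] V_add[of 1 "- 1"] V_0 U_inv A_inv
    by (simp_all add: S_def)
  have words: "short_word Homeo0 S n (V (int n))" "short_word Homeo0 S n (V (- int n))"
    "short_word Homeo0 S 1 (U 1)" "short_word Homeo0 S 1 (U (- 1))"
    "short_word Homeo0 S 1 A" "short_word Homeo0 S 1 A'" for n
    unfolding V_pow using letters
    by (simp_all only: short_word_funpow[OF S] group.short_word_letter[OF group_Homeo0 S])
  note comp = group.short_word_mult[OF group_Homeo0 S, unfolded mult_Homeo0]
  have "short_word Homeo0 S (4 * n + 4) (h n)" for n
  proof -
    have "(V (- int n) \<circ> A \<circ> V (int n)) \<circ> U 1 \<circ> (V (- int n) \<circ> A' \<circ> V (int n)) \<circ> U (- 1) = h n"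
      unfolding g(2) V_def U_def A_def A'_def on_cells_comp
      by (simp only: stack_commutator[OF g(1)])
    \<comment> \<open>The conjugates of \<open>A\<close> and \<open>A'\<close> take
      \<open>2 * n + 1\<close> letters each; \<open>U 1\<close> and \<open>U (- 1)\<close> add two
      more.\<close>
    moreover have "short_word Homeo0 S ((n + 1 + n) + 1 + (n + 1 + n) + 1)
        ((V (- int n) \<circ> A \<circ> V (int n)) \<circ> U 1 \<circ> (V (- int n) \<circ> A' \<circ> V (int n)) \<circ> U (- 1))"
      by (intro comp words)
    ultimately show ?thesis
      by (auto intro: short_word_mono)
  qed
  moreover have "finite S" "card S \<le> 3"
    by (auto simp: S_def card_insert_if)
  ultimately show ?thesis
    using S that by blast
qed


section \<open>Factoring homeomorphisms of small displacement\<close>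

text \<open>The core is itself a copy of the line, with a coordinate three levels of
  \<open>squeeze\<close> deep in which its points can be translated.\<close>

lemma core_squeezeE:
  assumes "squeeze (squeeze 0) < u" "u < squeeze (squeeze 1)"
  obtains z where "u = squeeze (squeeze (squeeze z))"
proof -
  have "0 < u" "u < 1"
    using assms squeeze_bounds[of "squeeze 0"] squeeze_bounds[of "squeeze 1"] by linarith+
  then have u: "u = squeeze (unsqueeze u)"
    by (simp add: squeeze_unsqueeze)
  define v where "v = unsqueeze u"
  have "squeeze 0 < v" "v < squeeze 1"
    using assms u by (metis squeeze_less_iff v_def)+
  then have "0 < v" "v < 1"
    using squeeze_bounds[of 0] squeeze_bounds[of 1] by linarith+
  then have "v = squeeze (unsqueeze v)"
    by (simp add: squeeze_unsqueeze)
  moreover define w where "w = unsqueeze v"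
  ultimately have v: "v = squeeze w" by simp
  with \<open>squeeze 0 < v\<close> \<open>v < squeeze 1\<close> have "w = squeeze (unsqueeze w)"
    by (simp add: squeeze_unsqueeze)
  with u v v_def that show ?thesis by metis
qed

text \<open>The first factor is \<open>h\<close> truncated between two fixed homeomorphisms \<open>L\<close> and \<open>M\<close> that are the
  identity off the cores and push \<open>[j + 1/4, j + 3/4]\<close> far to the left and to the right.\<close>

lemma core_factorization:
  obtains \<epsilon> where "\<epsilon> > 0"
    "\<And>h. aut h \<Longrightarrow> (\<And>j. of_int j + 1/4 - \<epsilon> \<le> h (of_int j + 1/4)) \<Longrightarrow>
       (\<And>j. h (of_int j + 3/4) \<le> of_int j + 3/4 + \<epsilon>) \<Longrightarrow>
       \<exists>p q. aut p \<and> aut q \<and> core_supported p \<and> core_supported q \<and>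
         h = p \<circ> ((\<lambda>x. x + 1/2) \<circ> q \<circ> (\<lambda>x. x - 1/2))"
proof -
  let ?s = "\<lambda>z. squeeze (squeeze (squeeze z))"
  \<comment> \<open>\<open>a\<close> and \<open>b\<close> are the innermost coordinates of 1/4 and
    3/4, which lie in the core.\<close>
  obtain a where a: "1/4 = ?s a"
    by (rule core_squeezeE[of "1/4"]) (use squeeze_squeeze_0 squeeze_squeeze_1 in linarith)+
  obtain b where b: "3/4 = ?s b"
    by (rule core_squeezeE[of "3/4"]) (use squeeze_squeeze_0 squeeze_squeeze_1 in linarith)+
  define P where "P t = on_cells (\<lambda>j. on_unit_cell (on_unit_cell (\<lambda>x. x + t)))" for t :: real
  have P: "P t (of_int j + ?s y) = of_int j + ?s (y + t)" for t j y
    by (simp add: P_def)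
  have aut_P: "aut (P t)" for t
    by (simp add: P_def aut_on_cells aut_on_unit_cell aut_translation)
  have core_P: "core_supported (P t)" for t
    by (simp add: P_def core_supported_on_cells)
  \<comment> \<open>Translation by \<open>b - a + 1\<close> takes \<open>a\<close> to
    \<open>b + 1\<close>, so \<open>M\<close> sends 1/4 beyond 3/4. Likewise \<open>L\<close> sends
    3/4 below 1/4, and \<open>\<epsilon>\<close> is the smaller of the two margins.\<close>
  define M where "M = P (b - a + 1)"
  define L where "L = P (a - b - 1)"
  define \<epsilon> where "\<epsilon> = min (?s (b + 1) - 3/4) (1/4 - ?s (a - 1))"
  have M: "of_int j + 3/4 + \<epsilon> \<le> M (of_int j + 1/4)" for j
    using P[of "b - a + 1" j a] by (simp add: a[symmetric] M_def \<epsilon>_def)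
  have L: "L (of_int j + 3/4) \<le> of_int j + 1/4 - \<epsilon>" for j
    using P[of "a - b - 1" j b] by (simp add: b[symmetric] L_def \<epsilon>_def)
  have "\<epsilon> > 0"
  proof -
    have "?s (a - 1) < ?s a" "?s b < ?s (b + 1)" by simp_all
    with a b show ?thesis unfolding \<epsilon>_def by linarith
  qed
  moreover have "\<exists>p q. aut p \<and> aut q \<and> core_supported p \<and> core_supported q \<and>
         h = p \<circ> ((\<lambda>x. x + 1/2) \<circ> q \<circ> (\<lambda>x. x - 1/2))"
    if h: "aut h" and lower: "\<And>j. of_int j + 1/4 - \<epsilon> \<le> h (of_int j + 1/4)"
      and upper: "\<And>j. h (of_int j + 3/4) \<le> of_int j + 3/4 + \<epsilon>" for h
  proof -
    \<comment> \<open>Off the cores \<open>L\<close> and \<open>M\<close> are the identity, which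
      forces the same on \<open>p\<close>. On \<open>[j + 1/4, j + 3/4]\<close> the map
      \<open>h\<close> lies between \<open>L\<close> and \<open>M\<close>, so \<open>p\<close>
      agrees with it.\<close>
    define p where "p x = max (L x) (min (h x) (M x))" for x
    have p: "aut p"
      unfolding p_def by (intro aut_max aut_min h) (auto simp: L_def M_def aut_P)
    have core_p: "core_supported p"
      using core_P unfolding core_supported_def p_def L_def M_def by auto
    have eq: "p (of_int j + x) = h (of_int j + x)" if "1/4 \<le> x" "x \<le> 3/4" for j x
    proof -
      have "h (of_int j + x) \<le> h (of_int j + 3/4)" "M (of_int j + 1/4) \<le> M (of_int j + x)"
        "h (of_int j + 1/4) \<le> h (of_int j + x)" "L (of_int j + x) \<le> L (of_int j + 3/4)"
        using that h aut_P by (simp_all add: aut_le_iff L_def M_def)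
      with L[of j] M[of j] lower[of j] upper[of j] show ?thesis
        unfolding p_def by linarith
    qed
    \<comment> \<open>\<open>fun_inv p \<circ> h\<close> is the identity on every
      \<open>[j + 1/4, j + 3/4]\<close>; moved by 1/2, these intervals cover everything outside the
      cores.\<close>
    define q where "q = (\<lambda>x. x - 1/2) \<circ> (fun_inv p \<circ> h) \<circ> (\<lambda>x. x + 1/2)"
    have q: "aut q"
      using aut_translation[of "- 1/2"] aut_translation[of "1/2"] h aut_inv[OF p]
      unfolding q_def by (intro aut_comp) simp_all
    have "core_supported q"
      unfolding core_supported_def
    proof (intro allI impI)
      fix j :: int and x
      assume x: "x \<in> {0..1} - {squeeze (squeeze 0)<..<squeeze (squeeze 1)}"
      have "p (of_int j + x + 1/2) = h (of_int j + x + 1/2)"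
      proof (cases "x \<le> squeeze (squeeze 0)")
        case True
        with x squeeze_squeeze_0 show ?thesis
          using eq[of "x + 1/2" j] by (simp add: algebra_simps)
      next
        case False
        with x squeeze_squeeze_1 show ?thesis
          using eq[of "x - 1/2" "j + 1"] by (simp add: algebra_simps)
      qed
      then have "fun_inv p (h (of_int j + x + 1/2)) = of_int j + x + 1/2"
        using p by (metis aut_inv_apply(1))
      then show "q (of_int j + x) = of_int j + x"
        by (simp add: q_def)
    qed
    moreover have "h = p \<circ> ((\<lambda>x. x + 1/2) \<circ> q \<circ> (\<lambda>x. x - 1/2))"
      using p by (simp add: q_def fun_eq_iff)
    ultimately show ?thesis
      using p q core_p by blast
  qed
  ultimately show ?thesis
    using that by blast
qed


section \<open>Coordinates in which a sequence has small displacement near infinity\<close>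

lemma real_sequence_cell:
  fixes T :: "int \<Rightarrow> real"
  assumes "\<And>k. T k + 1 \<le> T (k + 1)"
  obtains k where "T k \<le> z" "z < T (k + 1)"
proof -
  have up: "T 0 + real n \<le> T (int n)" for n
  proof (induction n)
    case (Suc n)
    with assms[of "int n"] show ?case by (simp add: add.commute)
  qed simp
  have down: "T (- int n) \<le> T 0 - real n" for n
  proof (induction n)
    case (Suc n)
    with assms[of "- int (Suc n)"] show ?case by simp
  qed simp
  obtain m where "real m > T 0 - z"
    using reals_Archimedean2 by blast
  with down[of m] have m: "T (- int m) \<le> z" by linarith
  obtain n where "real n > z - T 0"
    using reals_Archimedean2 by blast
  with up[of n] have n: "z < T (int n)" by linarith
  \<comment> \<open>\<open>LEAST\<close> searches the naturals, so the index is offset by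
    \<open>m\<close>. As \<open>T (- int m) \<le> z\<close>, the least \<open>i\<close> is not 0,
    and its predecessor gives the cell.\<close>
  define i where "i = (LEAST i. z < T (int i - int m))"
  have i: "z < T (int i - int m)"
    unfolding i_def by (rule LeastI[of _ "n + m"]) (simp add: n)
  with m have "i \<noteq> 0" by (intro notI) simp
  then obtain i' where i': "i = Suc i'"
    using not0_implies_Suc by blast
  have "\<not> z < T (int i' - int m)"
    using i' not_less_Least[of i' "\<lambda>i. z < T (int i - int m)"] by (simp add: i_def)
  with i i' that[of "int i' - int m"] show ?thesis by (simp add: algebra_simps)
qed

text \<open>Piecewise linear interpolation; increments of at least 1 make it surjective, by
  \<open>real_sequence_cell\<close>.\<close>

lemma aut_interpolation:
  fixes T :: "int \<Rightarrow> real"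
  assumes T: "\<And>k. T k + 1 \<le> T (k + 1)"
  obtains \<theta> where "aut \<theta>" "\<And>k. \<theta> (of_int k) = T k"
proof
  define \<theta> where "\<theta> x = T \<lfloor>x\<rfloor> + (x - of_int \<lfloor>x\<rfloor>) * (T (\<lfloor>x\<rfloor> + 1) - T \<lfloor>x\<rfloor>)" for x :: real
  have pos: "0 < T (k + 1) - T k" for k
    using T[of k] by linarith
  have less: "T k < T l" if "k < l" for k l
    using that
  proof (induction l rule: int_gr_induct)
    case base
    then show ?case using pos[of k] by simp
  next
    case (step l)
    then show ?case using pos[of l] by linarith
  qed
  have lower: "T \<lfloor>x\<rfloor> \<le> \<theta> x" for x
    using pos[of "\<lfloor>x\<rfloor>"] by (simp add: \<theta>_def)
  have upper: "\<theta> x < T (\<lfloor>x\<rfloor> + 1)" for x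
  proof -
    have "(x - of_int \<lfloor>x\<rfloor>) * (T (\<lfloor>x\<rfloor> + 1) - T \<lfloor>x\<rfloor>) < 1 * (T (\<lfloor>x\<rfloor> + 1) - T \<lfloor>x\<rfloor>)"
      using pos[of "\<lfloor>x\<rfloor>"] by (intro mult_strict_right_mono) linarith+
    then show ?thesis by (simp add: \<theta>_def)
  qed
  show "\<theta> (of_int k) = T k" for k
    by (simp add: \<theta>_def)
  show "aut \<theta>"
  proof (rule autI)
    show "strict_mono \<theta>"
    proof (rule strict_monoI)
      fix x y :: real assume "x < y"
      show "\<theta> x < \<theta> y"
      proof (cases "\<lfloor>x\<rfloor> = \<lfloor>y\<rfloor>")
        case True
        with \<open>x < y\<close> pos[of "\<lfloor>y\<rfloor>"] show ?thesis
          by (simp add: \<theta>_def)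
      next
        case False
        with \<open>x < y\<close> have "\<lfloor>x\<rfloor> + 1 \<le> \<lfloor>y\<rfloor>"
          by linarith
        then have "T (\<lfloor>x\<rfloor> + 1) \<le> T \<lfloor>y\<rfloor>"
          using less[of "\<lfloor>x\<rfloor> + 1" "\<lfloor>y\<rfloor>"] by (cases "\<lfloor>x\<rfloor> + 1 = \<lfloor>y\<rfloor>") auto
        with lower[of y] upper[of x] show ?thesis by linarith
      qed
    qed
    fix z
    obtain k where k: "T k \<le> z" "z < T (k + 1)"
      using real_sequence_cell[of T] T by blast
    define r where "r = (z - T k) / (T (k + 1) - T k)"
    have r: "0 \<le> r" "r < 1" "r * (T (k + 1) - T k) = z - T k"
      using k pos[of k] by (simp_all add: r_def)
    then have "\<lfloor>of_int k + r\<rfloor> = k"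
      by (simp add: floor_eq_iff)
    with r(3) have "\<theta> (of_int k + r) = z"
      by (simp add: \<theta>_def)
    then show "\<exists>x. \<theta> x = z" ..
  qed
qed

text \<open>Only the finitely many \<open>n \<le> \<bar>k\<bar>\<close> matter at index
  \<open>k\<close>, so \<open>s\<close> can be chosen recursively past the values at
  \<open>s m\<close> and \<open>- s m\<close> of the relevant \<open>f n\<close> and of their
  inverses. The former prevent outward jumps of more than one step, the latter inward ones.\<close>

lemma dominating_sequence:
  fixes f :: "nat \<Rightarrow> real \<Rightarrow> real"
  assumes f: "\<And>n. aut (f n)"
  obtains T :: "int \<Rightarrow> real" where "\<And>k. T k + 1 \<le> T (k + 1)"
    "\<And>n k. int n \<le> \<bar>k\<bar> \<Longrightarrow> T (k - 1) \<le> f n (T k) \<and> f n (T k) \<le> T (k + 1)"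
proof -
  \<comment> \<open>The sum runs to \<open>Suc m\<close>: the inward bound at index
    \<open>m + 1\<close> uses inverses at \<open>s m\<close>, with \<open>n\<close> up to
    \<open>m + 1\<close>.\<close>
  define B where "B m x = x + 1 + (\<Sum>n\<le>Suc m. \<bar>f n x\<bar> + \<bar>f n (- x)\<bar> + \<bar>fun_inv (f n) x\<bar> + \<bar>fun_inv (f n) (- x)\<bar>)"
    for m and x :: real
  define s where "s = rec_nat 0 B"
  have s_0: "s 0 = 0" and s_Suc: "s (Suc m) = B m (s m)" for m
    by (simp_all add: s_def)
  have step: "s m + 1 \<le> s (Suc m)" for m
    unfolding s_Suc B_def by (simp add: sum_nonneg)
  have nonneg: "0 \<le> s m" for m
  proof (induction m)
    case (Suc m)
    with step[of m] show ?case by linarith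
  qed (simp add: s_0)
  have bound: "\<bar>f n (s m)\<bar> \<le> s (Suc m) \<and> \<bar>f n (- s m)\<bar> \<le> s (Suc m) \<and>
      \<bar>fun_inv (f n) (s m)\<bar> \<le> s (Suc m) \<and> \<bar>fun_inv (f n) (- s m)\<bar> \<le> s (Suc m)" if "n \<le> Suc m" for n m
  proof -
    let ?b = "\<lambda>n. \<bar>f n (s m)\<bar> + \<bar>f n (- s m)\<bar> + \<bar>fun_inv (f n) (s m)\<bar> + \<bar>fun_inv (f n) (- s m)\<bar>"
    have "?b n \<le> sum ?b {..Suc m}"
      using that by (intro member_le_sum) auto
    with nonneg[of m] show ?thesis
      unfolding s_Suc B_def by linarith
  qed
  define T where "T k = (if k \<ge> 0 then s (nat k) else - s (nat (- k)))" for k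
  have T_nonneg: "T (int m) = s m" and T_nonpos: "T (- int m) = - s m" for m
    by (auto simp: T_def s_0)
  have T_Suc: "T (int m + 1) = s (Suc m)" and T_minus_Suc: "T (- int m - 1) = - s (Suc m)" for m
    using T_nonneg[of "Suc m"] T_nonpos[of "Suc m"] by (simp_all add: algebra_simps minus_diff_commute)
  have cases: "(\<exists>m. k = int m) \<or> (\<exists>m. k = - int (Suc m))" for k
    by (metis int_cases)
  show ?thesis
  proof (rule that[of T])
    fix k
    from cases[of k] show "T k + 1 \<le> T (k + 1)"
    proof (elim disjE exE)
      fix m assume "k = int m"
      then show ?thesis using step[of m] by (simp add: T_nonneg T_Suc)
    next
      fix m assume "k = - int (Suc m)"
      then show ?thesis using step[of m] T_nonpos[of "Suc m"] T_nonpos[of m] by simp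
    qed
    fix n assume n: "int n \<le> \<bar>k\<bar>"
    from cases[of k] show "T (k - 1) \<le> f n (T k) \<and> f n (T k) \<le> T (k + 1)"
    proof (elim disjE exE)
      fix m assume k: "k = int m"
      with n have "n \<le> m" by simp
      have "T (k - 1) \<le> f n (T k)"
      proof (cases m)
        \<comment> \<open>Here the lower neighbour is \<open>- s 1\<close>, so the bound on
          \<open>f n\<close> itself is used, not that on the inverse.\<close>
        case 0
        with k \<open>n \<le> m\<close> bound[of n 0] T_minus_Suc[of 0] T_nonneg[of 0] show ?thesis by auto
      next
        case (Suc l)
        with \<open>n \<le> m\<close> have "fun_inv (f n) (s l) \<le> s m"
          using bound[of n l] by auto
        then have "s l \<le> f n (s m)"
          using f by (simp add: aut_inv_le_iff)
        with Suc k T_nonneg[of l] T_nonneg[of m] show ?thesis by simp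
      qed
      moreover have "f n (T k) \<le> T (k + 1)"
        using k \<open>n \<le> m\<close> bound[of n m] by (auto simp: T_nonneg T_Suc)
      ultimately show ?thesis ..
    next
      fix m assume k: "k = - int (Suc m)"
      with n have "n \<le> Suc m" by simp
      have Tk: "T k = - s (Suc m)" "T (k - 1) = - s (Suc (Suc m))" "T (k + 1) = - s m"
        using k T_nonpos[of "Suc m"] T_minus_Suc[of "Suc m"] T_nonpos[of m] by simp_all
      have "- s (Suc m) \<le> fun_inv (f n) (- s m)"
        using bound[OF \<open>n \<le> Suc m\<close>] by linarith
      then have "f n (- s (Suc m)) \<le> - s m"
        using f by (simp add: aut_le_inv_iff)
      moreover have "- s (Suc (Suc m)) \<le> f n (- s (Suc m))"
        using bound[of n "Suc m"] \<open>n \<le> Suc m\<close> by auto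
      ultimately show ?thesis by (simp add: Tk)
    qed
  qed
qed

text \<open>In the coordinate \<open>\<eta>\<close> interpolating \<open>T\<close>, the displacement
  is at most 2 from distance \<open>n + 1\<close> on: one unit for the step to a neighbour and one
  for rounding. Rescaling by \<open>2 / \<epsilon>\<close> turns 2 into
  \<open>\<epsilon>\<close>.\<close>

lemma taming_coordinates:
  fixes f :: "nat \<Rightarrow> real \<Rightarrow> real"
  assumes f: "\<And>n. aut (f n)" and "\<epsilon> > 0"
  obtains \<theta> where "aut \<theta>"
    "\<And>n y. \<epsilon> * (real n + 1) \<le> \<bar>y\<bar> \<Longrightarrow> \<bar>fun_inv \<theta> (f n (\<theta> y)) - y\<bar> \<le> \<epsilon>"
proof -
  obtain T where T: "\<And>k. T k + 1 \<le> T (k + 1)"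
    "\<And>n k. int n \<le> \<bar>k\<bar> \<Longrightarrow> T (k - 1) \<le> f n (T k) \<and> f n (T k) \<le> T (k + 1)"
    using dominating_sequence[of f] f by blast
  obtain \<eta> where \<eta>: "aut \<eta>" "\<And>k. \<eta> (of_int k) = T k"
    using aut_interpolation[of T] T(1) by blast
  have \<eta>_bound: "\<eta> (y - 2) \<le> f n (\<eta> y) \<and> f n (\<eta> y) \<le> \<eta> (y + 2)" if y: "real n + 1 \<le> \<bar>y\<bar>" for n y
  proof -
    define k where "k = \<lfloor>y\<rfloor>"
    have k: "of_int k \<le> y" "y < of_int (k + 1)"
      by (simp_all add: k_def)
    \<comment> \<open>The \<open>+ 1\<close> in the bound on \<open>y\<close> leaves room for
      \<open>k + 1\<close>, which for negative \<open>y\<close> can be closer to 0 than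
      \<open>y\<close>.\<close>
    have nk: "int n \<le> \<bar>k\<bar>" "int n \<le> \<bar>k + 1\<bar>"
      using y k by linarith+
    have "\<eta> (y - 2) \<le> \<eta> (of_int (k - 1))"
      using k by (simp add: \<eta>(1) aut_le_iff)
    also have "\<dots> \<le> f n (\<eta> (of_int k))"
      unfolding \<eta>(2) using T(2)[OF nk(1)] by simp
    also have "\<dots> \<le> f n (\<eta> y)"
      using k by (simp add: f \<eta>(1) aut_le_iff)
    finally have lower: "\<eta> (y - 2) \<le> f n (\<eta> y)" .
    have "f n (\<eta> y) \<le> f n (\<eta> (of_int (k + 1)))"
      using k by (simp add: f \<eta>(1) aut_le_iff)
    also have "\<dots> \<le> \<eta> (of_int (k + 1 + 1))"
      unfolding \<eta>(2) using T(2)[OF nk(2)] by simp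
    also have "\<dots> \<le> \<eta> (y + 2)"
      using k by (simp add: \<eta>(1) aut_le_iff)
    finally show ?thesis using lower by simp
  qed
  define c where "c = 2 / \<epsilon>"
  have c: "c > 0" "c * \<epsilon> \<ge> 2"
    using \<open>\<epsilon> > 0\<close> by (simp_all add: c_def)
  define \<theta> where "\<theta> = \<eta> \<circ> (\<lambda>x. c * x)"
  have \<theta>: "aut \<theta>"
    unfolding \<theta>_def by (intro aut_comp \<eta>(1) aut_scale c)
  moreover have "\<bar>fun_inv \<theta> (f n (\<theta> y)) - y\<bar> \<le> \<epsilon>" if y: "\<epsilon> * (real n + 1) \<le> \<bar>y\<bar>" for n y
  proof -
    have "real n + 1 \<le> (c * \<epsilon>) * (real n + 1)"
      using c(2) mult_right_mono[of 1 "c * \<epsilon>" "real n + 1"] by simp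
    also have "\<dots> \<le> \<bar>c * y\<bar>"
      using mult_left_mono[OF y, of c] c(1) by (simp add: abs_mult mult.assoc)
    finally have *: "\<eta> (c * y - 2) \<le> f n (\<eta> (c * y)) \<and> f n (\<eta> (c * y)) \<le> \<eta> (c * y + 2)"
      by (rule \<eta>_bound)
    have "\<eta> (c * (y - \<epsilon>)) \<le> \<eta> (c * y - 2)" "\<eta> (c * y + 2) \<le> \<eta> (c * (y + \<epsilon>))"
      using c(2) by (simp_all add: \<eta>(1) aut_le_iff algebra_simps)
    with * have "\<theta> (y - \<epsilon>) \<le> f n (\<theta> y)" "f n (\<theta> y) \<le> \<theta> (y + \<epsilon>)"
      by (simp_all add: \<theta>_def)
    then have "y - \<epsilon> \<le> fun_inv \<theta> (f n (\<theta> y))" "fun_inv \<theta> (f n (\<theta> y)) \<le> y + \<epsilon>"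
      using \<theta> by (simp_all add: aut_le_inv_iff aut_inv_le_iff)
    then show ?thesis by linarith
  qed
  ultimately show ?thesis
    using that by blast
qed

section \<open>Assembling the generating set\<close>

lemma short_word_homotheties:
  assumes "S \<subseteq> carrier Homeo0" "(\<lambda>x. 2 * x) \<in> S"
  shows "short_word Homeo0 S n (\<lambda>x. 2 ^ n * x)" "short_word Homeo0 S n (\<lambda>x. x / 2 ^ n)"
proof -
  have "(\<lambda>x::real. 2 * x) \<circ> (\<lambda>x. x / 2) = id"
    by (simp add: fun_eq_iff)
  then have "(\<lambda>x::real. x / 2) \<in> S \<union> m_inv Homeo0 ` S"
    using assms by (rule short_word_inv_letter[rotated 2])
  moreover have "(\<lambda>x::real. 2 * x) ^^ n = (\<lambda>x. 2 ^ n * x)" "(\<lambda>x::real. x / 2) ^^ n = (\<lambda>x. x / 2 ^ n)"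
    by (induction n) (auto simp: fun_eq_iff)
  ultimately show "short_word Homeo0 S n (\<lambda>x. 2 ^ n * x)" "short_word Homeo0 S n (\<lambda>x. x / 2 ^ n)"
    using assms short_word_funpow[OF assms(1), of _ n] by (metis UnI1)+
qed

text \<open>The doubling map, three letters for \<open>p\<close> and three for the translated
  \<open>q\<close> make seven. Two words of length \<open>4 * n + 4\<close>, with \<open>n\<close>
  doublings on one side and \<open>n\<close> halvings on the other, make
  \<open>10 * n + 8\<close>.\<close>

lemma generators_with_linear_word_length:
  fixes f :: "nat \<Rightarrow> real \<Rightarrow> real"
  assumes f: "\<And>n. aut (f n)"
  obtains S where "S \<subseteq> carrier Homeo0" "finite S" "card S \<le> 7"
    "\<And>n. short_word Homeo0 S (10 * n + 8) (f n)"
proof -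
  obtain \<epsilon> where \<epsilon>: "\<epsilon> > 0"
    "\<And>h. aut h \<Longrightarrow> (\<And>j. of_int j + 1/4 - \<epsilon> \<le> h (of_int j + 1/4)) \<Longrightarrow>
       (\<And>j. h (of_int j + 3/4) \<le> of_int j + 3/4 + \<epsilon>) \<Longrightarrow>
       \<exists>p q. aut p \<and> aut q \<and> core_supported p \<and> core_supported q \<and>
         h = p \<circ> ((\<lambda>x. x + 1/2) \<circ> q \<circ> (\<lambda>x. x - 1/2))"
    using core_factorization by blast
  \<comment> \<open>With \<open>\<delta> \<le> 1/4\<close>, scaling by \<open>2 ^ n\<close> takes
    points at distance at least 1/4 from 0 to distance at least \<open>\<delta> * (n + 1)\<close>,
    where \<open>\<theta>\<close> tames \<open>f n\<close>.\<close>
  define \<delta> where "\<delta> = min \<epsilon> (1/4)"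
  have \<delta>: "0 < \<delta>" "\<delta> \<le> \<epsilon>" "\<delta> \<le> 1/4"
    using \<epsilon>(1) by (simp_all add: \<delta>_def)
  obtain \<theta> where \<theta>: "aut \<theta>"
    "\<And>n y. \<delta> * (real n + 1) \<le> \<bar>y\<bar> \<Longrightarrow> \<bar>fun_inv \<theta> (f n (\<theta> y)) - y\<bar> \<le> \<delta>"
    using taming_coordinates[of f \<delta>] f \<delta>(1) by blast
  define h where "h n = (\<lambda>x. x / 2 ^ n) \<circ> (fun_inv \<theta> \<circ> f n \<circ> \<theta>) \<circ> (\<lambda>x. 2 ^ n * x)" for n :: nat
  have h_close: "\<bar>h n x - x\<bar> \<le> \<epsilon>" if "1/4 \<le> \<bar>x\<bar>" for n x
  proof -
    have "real n + 1 \<le> 2 ^ n"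
      by (induction n) auto
    then have "\<delta> * (real n + 1) \<le> \<bar>x\<bar> * 2 ^ n"
      using \<delta> that by (intro mult_mono) auto
    then have "\<bar>fun_inv \<theta> (f n (\<theta> (2 ^ n * x))) - 2 ^ n * x\<bar> \<le> \<delta>"
      by (intro \<theta>(2)) (simp add: abs_mult mult.commute)
    moreover have "fun_inv \<theta> (f n (\<theta> (2 ^ n * x))) - 2 ^ n * x = 2 ^ n * (h n x - x)"
      by (simp add: h_def field_simps)
    ultimately have "2 ^ n * \<bar>h n x - x\<bar> \<le> \<delta>"
      by (simp add: abs_mult)
    moreover have "1 * \<bar>h n x - x\<bar> \<le> 2 ^ n * \<bar>h n x - x\<bar>"
      by (intro mult_right_mono) auto
    ultimately show ?thesis
      using \<delta>(2) by (metis mult_1 order_trans)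
  qed
  have "\<exists>p q. aut p \<and> aut q \<and> core_supported p \<and> core_supported q \<and>
         h n = p \<circ> ((\<lambda>x. x + 1/2) \<circ> q \<circ> (\<lambda>x. x - 1/2))" for n
  proof (rule \<epsilon>(2))
    show "aut (h n)"
      unfolding h_def using aut_scale[of "1 / 2 ^ n"] aut_scale[of "2 ^ n"] f \<theta>(1) aut_inv[OF \<theta>(1)]
      by (intro aut_comp) simp_all
    \<comment> \<open>The estimate \<open>h_close\<close> says nothing near 0, but these points all
      stay at distance at least 1/4 from it.\<close>
    have far: "1/4 \<le> \<bar>real_of_int j + 1/4\<bar>" "1/4 \<le> \<bar>real_of_int j + 3/4\<bar>" for j
      by (cases "j \<ge> 0"; linarith)+
    show "of_int j + 1/4 - \<epsilon> \<le> h n (of_int j + 1/4)" for j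
      using h_close[OF far(1)[of j], of n] by linarith
    show "h n (of_int j + 3/4) \<le> of_int j + 3/4 + \<epsilon>" for j
      using h_close[OF far(2)[of j], of n] by linarith
  qed
  then obtain p q where pq: "\<And>n. aut (p n)" "\<And>n. aut (q n)" "\<And>n. core_supported (p n)"
      "\<And>n. core_supported (q n)"
      and h_eq: "\<And>n. h n = p n \<circ> ((\<lambda>x. x + 1/2) \<circ> q n \<circ> (\<lambda>x. x - 1/2))"
    by metis
  obtain P where P: "P \<subseteq> carrier Homeo0" "finite P" "card P \<le> 3"
    "\<And>n. short_word Homeo0 P (4 * n + 4) (p n)"
    using swindle[of p] pq by blast
  obtain Q where Q: "Q \<subseteq> carrier Homeo0" "finite Q" "card Q \<le> 3"
    "\<And>n. short_word Homeo0 Q (4 * n + 4) (q n)"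
    using swindle[of q] pq by blast
  have conj: "x \<otimes>\<^bsub>Homeo0\<^esub> s \<otimes>\<^bsub>Homeo0\<^esub> inv\<^bsub>Homeo0\<^esub> x = x \<circ> s \<circ> fun_inv x" if "aut x" for x s
    using that by (simp add: mult_Homeo0 inv_Homeo0)
  define \<tau> where "\<tau> = (\<lambda>x::real. x + 1/2)"
  have \<tau>: "aut \<tau>"
    unfolding \<tau>_def by (rule aut_translation)
  have \<tau>_inv: "fun_inv \<tau> = (\<lambda>x. x - 1/2)"
    using \<tau> by (rule fun_inv_unique) (simp add: \<tau>_def fun_eq_iff)
  \<comment> \<open>Conjugation by the half translation \<open>\<tau>\<close> turns words for
    \<open>q n\<close> into words for the factor supported in the translated cores.\<close>
  define R where "R = insert (\<lambda>x. 2 * x) (P \<union> (\<lambda>s. \<tau> \<circ> s \<circ> fun_inv \<tau>) ` Q)"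
  have R: "R \<subseteq> carrier Homeo0"
    using P(1) Q(1) \<tau> aut_scale[of 2]
    by (auto simp: R_def carrier_Homeo0 intro!: aut_comp aut_inv)
  have "card (P \<union> (\<lambda>s. \<tau> \<circ> s \<circ> fun_inv \<tau>) ` Q) \<le> 3 + 3"
    by (rule order_trans[OF card_Un_le add_mono[OF P(3) order_trans[OF card_image_le[OF Q(2)] Q(3)]]])
  then have R_card: "finite R" "card R \<le> 7"
    using P(2) Q(2) by (simp_all add: R_def card_insert_if)
  note comp = group.short_word_mult[OF group_Homeo0 R, unfolded mult_Homeo0]
  note scale = short_word_homotheties[OF R, unfolded R_def, OF insertI1, folded R_def]
  have word: "short_word Homeo0 R (10 * n + 8) (fun_inv \<theta> \<circ> f n \<circ> \<theta>)" for n
  proof -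
    have "fun_inv \<theta> \<circ> f n \<circ> \<theta> = (\<lambda>x. 2 ^ n * x) \<circ> h n \<circ> (\<lambda>x. x / 2 ^ n)"
      by (simp add: h_def fun_eq_iff)
    then have eq: "fun_inv \<theta> \<circ> f n \<circ> \<theta> =
        (\<lambda>x. 2 ^ n * x) \<circ> (p n \<circ> (\<tau> \<circ> q n \<circ> fun_inv \<tau>)) \<circ> (\<lambda>x. x / 2 ^ n)"
      unfolding h_eq \<tau>_inv unfolding \<tau>_def .
    have p_word: "short_word Homeo0 R (4 * n + 4) (p n)"
      using P(4) by (rule short_word_mono) (auto simp: R_def)
    have q_word: "short_word Homeo0 R (4 * n + 4) (\<tau> \<circ> q n \<circ> fun_inv \<tau>)"
      using group.short_word_conjugate[OF group_Homeo0 Q(1) _ Q(4), of \<tau> n] \<tau>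
      unfolding conj[OF \<tau>] carrier_Homeo0
      by (auto simp: R_def intro: short_word_mono)
    have "short_word Homeo0 R (n + ((4 * n + 4) + (4 * n + 4)) + n) (fun_inv \<theta> \<circ> f n \<circ> \<theta>)"
      unfolding eq by (rule comp[OF comp[OF scale(1) comp[OF p_word q_word]] scale(2)])
    then show ?thesis
      by (rule short_word_mono) auto
  qed
  \<comment> \<open>Conjugating the letters by \<open>\<theta>\<close> undoes the coordinate change
    without altering word lengths.\<close>
  define S where "S = (\<lambda>s. \<theta> \<circ> s \<circ> fun_inv \<theta>) ` R"
  show ?thesis
  proof (rule that[of S])
    show "S \<subseteq> carrier Homeo0"
      using R \<theta>(1) by (auto simp: S_def carrier_Homeo0 intro!: aut_comp aut_inv)
    show "finite S" "card S \<le> 7"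
      using R_card card_image_le[OF R_card(1)] by (auto simp: S_def intro: order_trans)
    fix n
    have "\<theta> \<circ> (fun_inv \<theta> \<circ> f n \<circ> \<theta>) \<circ> fun_inv \<theta> = f n"
      using \<theta>(1) by (simp add: fun_eq_iff)
    then show "short_word Homeo0 S (10 * n + 8) (f n)"
      using group.short_word_conjugate[OF group_Homeo0 R _ word, of \<theta> n] \<theta>(1)
      unfolding conj[OF \<theta>(1)] carrier_Homeo0 by (simp add: S_def)
  qed
qed

theorem proposition2p1:
  fixes f :: "nat \<Rightarrow> real \<Rightarrow> real"
  assumes "\<And>n. f n \<in> carrier Homeo0"
  shows "\<exists>S. S \<subseteq> carrier Homeo0 \<and> card S = 10 \<and>
           (\<forall>n. f n \<in> generate Homeo0 S \<and> word_length Homeo0 S (f n) \<le> 14 * n + 12)"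
proof -
  have "aut (f n)" for n
    using assms by (simp add: carrier_Homeo0)
  then obtain R where R: "R \<subseteq> carrier Homeo0" "finite R" "card R \<le> 7"
    "\<And>n. short_word Homeo0 R (10 * n + 8) (f n)"
    using generators_with_linear_word_length[of f] by blast
  \<comment> \<open>The at most seven letters are padded to exactly ten; words over \<open>R\<close>
    remain words over the larger set, and \<open>10 * n + 8 \<le> 14 * n + 12\<close>.\<close>
  have "infinite (carrier Homeo0 - R)"
    using infinite_Homeo0 R(2) by simp
  then obtain B where B: "finite B" "card B = 10 - card R" "B \<subseteq> carrier Homeo0 - R"
    using infinite_arbitrarily_large by blast
  have S: "R \<union> B \<subseteq> carrier Homeo0"
    using R(1) B(3) by auto
  have "card (R \<union> B) = card R + card B"
    using R(2) B by (intro card_Un_disjoint) auto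
  with R(3) B(2) have "card (R \<union> B) = 10" by simp
  moreover have word: "short_word Homeo0 (R \<union> B) (14 * n + 12) (f n)" for n
    using R(4) by (rule short_word_mono) auto
  ultimately show ?thesis
    using S group.short_word_generate[OF group_Homeo0 S word] word_length_le[OF word] by blast
qed

end
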